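(* Let $s\in\{2,3,\dots\}$ be fixed. Let $X$ be a random variable with $P(X>0)=1$, with cumulative distribution function $F$ and probability density function $f=F'$, and for each $k\in\mathbb{N}$ consider a sample of $n=(s+1)k-1$ independent observations on $X$ with increasing order statistics $X_{(1,n)}\le\dots\le X_{(n,n)}$. If $f\left[F^{\leftarrow}\left(\frac{1}{s+1}\right)\right]\in(0,\infty)$ and $f\left[F^{\leftarrow}\left(\frac{s}{s+1}\right)\right]\in(0,\infty)$, then $$\log\left(\frac{X_{(ks,(s+1)k-1)}}{X_{(k,(s+1)k-1)}}\right)\stackrel{P}{\to}\log\left[\frac{F^{\leftarrow}(\frac{s}{s+1})}{F^{\leftarrow}(\frac{1}{s+1})}\right],\qquad k\to\infty .$$
   Context: $F^{\leftarrow}(p)=\inf\{x: F(x)\ge p\}$ denotes the quantile function of $F$. $X_{(i,n)}$ denotes the $i$-th smallest of $n$ independent observations on $X$. $\stackrel{P}{\to}$ means convergence in probability, and $\log$ is the natural logarithm. *)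

theory Defs
  imports "HOL-Probability.Probability"
begin

text \<open>For the distribution function of a real random variable and \<open>0 < p < 1\<close> the set below is
  nonempty and bounded below, so the infimum is the genuine one.\<close>

definition quantile :: "(real \<Rightarrow> real) \<Rightarrow> real \<Rightarrow> real" where
  "quantile F p = Inf {x. p \<le> F x}"

text \<open>The \<open>i\<close>-th smallest of \<open>Y 1, \<dots>, Y n\<close>, counted from \<open>1\<close>;
  meaningful for \<open>1 \<le> i \<le> n\<close>.\<close>

definition order_statistic :: "nat \<Rightarrow> nat \<Rightarrow> (nat \<Rightarrow> 'a \<Rightarrow> real) \<Rightarrow> 'a \<Rightarrow> real" where
  "order_statistic i n Y \<omega> = sort (map (\<lambda>j. Y j \<omega>) [1..<Suc n]) ! (i - 1)"

text \<open>Measurability is part of the notion: \<open>measure M\<close> is \<open>0\<close> on non-measurable sets, so the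
  limit condition alone would be satisfied spuriously.\<close>

definition converges_in_probability ::
    "'a measure \<Rightarrow> (nat \<Rightarrow> 'a \<Rightarrow> real) \<Rightarrow> ('a \<Rightarrow> real) \<Rightarrow> bool" where
  "converges_in_probability M Z L \<longleftrightarrow>
     (\<forall>k. Z k \<in> borel_measurable M) \<and> L \<in> borel_measurable M \<and>
     (\<forall>\<epsilon>>0. (\<lambda>k. measure M {\<omega> \<in> space M. \<bar>Z k \<omega> - L \<omega>\<bar> > \<epsilon>}) \<longlonglongrightarrow> 0)"

end

theory Submission
  imports Defs
begin

text \<open>The \<open>i\<close>-th order statistic is at most \<open>x\<close> iff at least \<open>i\<close> observations are, so Hoeffding's
  inequality for the empirical distribution function at \<open>q - \<epsilon>\<close> and \<open>q + \<epsilon>\<close> shows that order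
  statistics of relative rank tending to \<open>p\<close> converge in probability to \<open>q = quantile F p\<close>,
  provided \<open>F (q - \<epsilon>) < p < F (q + \<epsilon>)\<close>. The left inequality is automatic and the right one
  follows from \<open>F' q > 0\<close>. As both quantiles are positive, the logarithm of their ratio is a
  continuous function of them.\<close>

section \<open>Order statistics through counting, and their measurability\<close>

text \<open>In a sorted list the positions with entry at most \<open>x\<close> form an initial
  segment, so it contains \<open>i\<close> exactly when it has more than \<open>i\<close> elements;
  sorting preserves the number of such entries.\<close>

lemma nth_sort_le_iff:
  fixes xs :: "'a::linorder list"
  assumes "i < length xs"
  shows "sort xs ! i \<le> x \<longleftrightarrow> i < length (filter (\<lambda>y. y \<le> x) xs)"
proof -
  define ys where "ys = sort xs"
  define K where "K = {k. k < length ys \<and> ys ! k \<le> x}"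
  have ys: "sorted ys" "i < length ys"
    using assms by (simp_all add: ys_def)
  have "card K = length (filter (\<lambda>y. y \<le> x) ys)"
    by (simp add: K_def length_filter_conv_card)
  then have K: "finite K" "card K = length (filter (\<lambda>y. y \<le> x) xs)"
    by (simp_all add: K_def ys_def filter_sort)
  have "i < card K" if "ys ! i \<le> x"
  proof -
    have "{..i} \<subseteq> K"
      using that ys sorted_nth_mono[OF ys(1)] by (force simp: K_def)
    from card_mono[OF K(1) this] show ?thesis by simp
  qed
  moreover have "card K \<le> i" if "\<not> ys ! i \<le> x"
  proof -
    have "K \<subseteq> {..<i}"
      using that ys sorted_nth_mono[OF ys(1)] by (force simp: K_def not_less[symmetric])
    from card_mono[OF _ this] show ?thesis by simp
  qed
  ultimately show ?thesis
    using K(2) by (force simp: ys_def)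
qed

lemma order_statistic_le_iff:
  assumes "1 \<le> i" "i \<le> n"
  shows "order_statistic i n Y \<omega> \<le> x \<longleftrightarrow> i \<le> card {j \<in> {1..n}. Y j \<omega> \<le> x}"
proof -
  have "length (filter (\<lambda>y. y \<le> x) (map (\<lambda>j. Y j \<omega>) [1..<Suc n])) =
      length (filter (\<lambda>j. Y j \<omega> \<le> x) [1..<Suc n])"
    by (simp add: filter_map o_def)
  also have "\<dots> = card {j \<in> {1..n}. Y j \<omega> \<le> x}"
    by (subst distinct_card[symmetric]) (auto intro: arg_cong[where f = card])
  finally show ?thesis
    \<comment> \<open>Ranks count from 1 and list positions from 0; as \<open>1 <= i\<close>,
      exceeding \<open>i - 1\<close> means being at least \<open>i\<close>.\<close>
    using nth_sort_le_iff[of "i - 1" "map (\<lambda>j. Y j \<omega>) [1..<Suc n]" x] assms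
    unfolding order_statistic_def by auto
qed

text \<open>An access past the end has an unspecified value, but unfolding \<open>!\<close> shows
  that it depends only on the overshoot, not on the entries. Hence an order statistic of a rank out
  of range is a constant function.\<close>

lemma nth_beyond_length:
  assumes "length xs \<le> n"
  shows "xs ! n = [] ! (n - length xs)"
  using assms
proof (induction xs arbitrary: n)
  case (Cons x xs)
  then show ?case by (cases n) auto
qed simp

text \<open>The rank is unrestricted because \<open>converges_in_probability\<close> demands
  measurability for every \<open>k\<close>, including \<open>k = 0\<close>, where the sample of the
  theorem is empty.\<close>

lemma borel_measurable_order_statistic:
  assumes [measurable]: "\<And>j. j \<in> {1..n} \<Longrightarrow> Y j \<in> borel_measurable M"
  shows "order_statistic i n Y \<in> borel_measurable M"
proof (cases "i - 1 < n")
  case True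
  \<comment> \<open>Truncated subtraction sends ranks 0 and 1 to the same position, so
    \<open>max i 1\<close> brings the rank into the domain of the counting criterion.\<close>
  have shift: "order_statistic i n Y = order_statistic (max i 1) n Y"
    by (auto simp: order_statistic_def fun_eq_iff max_def)
  have "(\<lambda>\<omega>. card {j \<in> {1..n}. Y j \<omega> \<le> x}) \<in> M \<rightarrow>\<^sub>M count_space UNIV" for x
    by measurable
  then have "{\<omega> \<in> space M. max i 1 \<le> card {j \<in> {1..n}. Y j \<omega> \<le> x}} \<in> sets M" for x
    by measurable
  then show ?thesis
    using True unfolding shift
    by (intro borel_measurable_iff_le[THEN iffD2]) (simp add: order_statistic_le_iff)
next
  case False
  then have "order_statistic i n Y \<omega> = [] ! (i - 1 - n)" for \<omega>
    unfolding order_statistic_def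
    by (subst nth_beyond_length) (simp_all del: upt_Suc)
  then have "order_statistic i n Y = (\<lambda>_. [] ! (i - 1 - n))" by (rule ext)
  then show ?thesis by simp
qed

section \<open>Concentration of the empirical distribution function and convergence of order
  statistics\<close>

text \<open>The indicators of \<open>Y j <= x\<close> are independent, take values in [0,1] and have
  mean \<open>F x\<close>; their sum is the count, so this is Hoeffding's inequality for
  them.\<close>

lemma (in prob_space) empirical_cdf_Hoeffding:
  fixes Y :: "nat \<Rightarrow> 'a \<Rightarrow> real" and n :: nat and \<epsilon> :: real
  assumes X [measurable]: "random_variable borel X"
    and indep: "indep_vars (\<lambda>_. borel) Y {1..n}"
    and distr: "\<And>j. j \<in> {1..n} \<Longrightarrow> distr M borel (Y j) = distr M borel X"
    and "n > 0" "\<epsilon> \<ge> 0"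
  shows "prob {\<omega> \<in> space M. \<bar>card {j \<in> {1..n}. Y j \<omega> \<le> x} / n - cdf (distr M borel X) x\<bar> \<ge> \<epsilon>}
    \<le> 2 * exp (- 2 * n * \<epsilon>\<^sup>2)"
proof -
  have Y [measurable]: "random_variable borel (Y j)" if "j \<in> {1..n}" for j
    using indep that by (auto simp: indep_vars_def)
  interpret Hoeffding_ineq_iid M "{1..n}" "\<lambda>j \<omega>. indicator {..x} (Y j \<omega>)"
    "\<lambda>\<omega>. indicator {..x} (X \<omega>)" 0 1 "cdf (distr M borel X) x"
  proof unfold_locales
    show "indep_vars (\<lambda>_. borel) (\<lambda>j \<omega>. indicator {..x} (Y j \<omega>) :: real) {1..n}"
      by (rule indep_vars_compose2[OF indep]) simp
    fix j assume j: "j \<in> {1..n}"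
    \<comment> \<open>The law of the indicator is the image of the law of the variable, so equality
      of the laws of \<open>Y j\<close> and \<open>X\<close> passes to the indicators.\<close>
    have "distr M borel (\<lambda>\<omega>. indicator {..x} (Z \<omega>) :: real) =
        distr (distr M borel Z) borel (indicator {..x})" if "random_variable borel Z" for Z
      using that by (subst distr_distr) (auto simp: o_def)
    from this[OF Y[OF j]] this[OF X]
    show "distr M borel (\<lambda>\<omega>. indicator {..x} (Y j \<omega>) :: real) =
        distr M borel (\<lambda>\<omega>. indicator {..x} (X \<omega>))"
      by (simp add: distr[OF j])
  next
    have "expectation (\<lambda>\<omega>. indicator {..x} (X \<omega>)) = cdf (distr M borel X) x"
      using integral_distr[OF X, of "indicator {..x} :: real \<Rightarrow> real"] by (simp add: cdf_def)
    then show "cdf (distr M borel X) x \<equiv> expectation (\<lambda>\<omega>. indicator {..x} (X \<omega>))"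
      by simp
  qed (auto simp: indicator_def)
  have "(\<Sum>j\<in>{1..n}. indicator {..x} (Y j \<omega>)) = real (card {j \<in> {1..n}. Y j \<omega> \<le> x})" for \<omega>
    by (simp add: indicator_def sum.If_cases Int_def)
  then show ?thesis
    using Hoeffding_ineq_abs_ge'[of \<epsilon>] assms(4,5) by simp
qed

text \<open>Only the limit \<open>p\<close> of the relative ranks enters, so one statement serves
  both order statistics of the theorem. The rank need be valid only eventually, which leaves room
  for the empty sample.\<close>

lemma (in prob_space) order_statistic_converges_in_probability:
  fixes Y :: "nat \<Rightarrow> nat \<Rightarrow> 'a \<Rightarrow> real" and q :: real
  assumes X: "random_variable borel X"
    and indep: "\<And>k. indep_vars (\<lambda>_. borel) (Y k) {1..n k}"
    and distr: "\<And>k j. j \<in> {1..n k} \<Longrightarrow> distr M borel (Y k j) = distr M borel X"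
    and rank: "\<forall>\<^sub>F k in sequentially. 1 \<le> i k \<and> i k \<le> n k"
    and n: "filterlim n at_top sequentially"
    and p: "(\<lambda>k. real (i k) / real (n k)) \<longlonglongrightarrow> p"
    and below: "\<And>e. e > 0 \<Longrightarrow> cdf (distr M borel X) (q - e) < p"
    and above: "\<And>e. e > 0 \<Longrightarrow> p < cdf (distr M borel X) (q + e)"
  shows "converges_in_probability M (\<lambda>k. order_statistic (i k) (n k) (Y k)) (\<lambda>_. q)"
  unfolding converges_in_probability_def
proof (intro conjI allI impI)
  have Y [measurable]: "random_variable borel (Y k j)" if "j \<in> {1..n k}" for k j
    using indep that by (auto simp: indep_vars_def)
  show meas [measurable]: "order_statistic (i k) (n k) (Y k) \<in> borel_measurable M" for k
    by (intro borel_measurable_order_statistic Y)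
  fix \<epsilon> :: real assume "\<epsilon> > 0"
  let ?O = "\<lambda>k. order_statistic (i k) (n k) (Y k)"
  define F where "F = cdf (distr M borel X)"
  \<comment> \<open>Half of the smaller gap between \<open>p\<close> and \<open>F\<close> at the two
    test points: one \<open>d\<close> absorbs the error of \<open>i k / n k\<close> against
    \<open>p\<close>, the other remains as deviation of the empirical distribution function.\<close>
  define d where "d = min (F (q + \<epsilon>) - p) (p - F (q - \<epsilon>)) / 2"
  define N where "N = (\<lambda>k x \<omega>. card {j \<in> {1..n k}. Y k j \<omega> \<le> x})"
  define A where "A = (\<lambda>k x. {\<omega> \<in> space M. \<bar>N k x \<omega> / n k - F x\<bar> \<ge> d})"
  have d: "d > 0" "p + d \<le> F (q + \<epsilon>) - d" "F (q - \<epsilon>) + d \<le> p - d"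
    using below[OF \<open>\<epsilon> > 0\<close>] above[OF \<open>\<epsilon> > 0\<close>] by (auto simp: d_def F_def min_def field_simps)
  have N [measurable]: "N k x \<in> M \<rightarrow>\<^sub>M count_space UNIV" for k x
    unfolding N_def by measurable
  have A [measurable]: "A k x \<in> events" for k x
    unfolding A_def by measurable
  have A_bound: "prob (A k x) \<le> 2 * exp (- 2 * real (n k) * d\<^sup>2)" if "n k > 0" for k x
    unfolding A_def N_def F_def using empirical_cdf_Hoeffding[OF X indep distr that] d(1) by simp
  have p_d: "p - d < p" "p < p + d"
    using d(1) by simp_all
  have bound: "\<forall>\<^sub>F k in sequentially. prob {\<omega> \<in> space M. \<bar>?O k \<omega> - q\<bar> > \<epsilon>} \<le> 4 * exp (- 2 * real (n k) * d\<^sup>2)"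
    using rank order_tendstoD(1)[OF p p_d(1)] order_tendstoD(2)[OF p p_d(2)]
  proof eventually_elim
    case (elim k)
    then have k: "1 \<le> i k" "i k \<le> n k" "p - d < i k / n k" "i k / n k < p + d"
      by auto
    have "{\<omega> \<in> space M. \<bar>?O k \<omega> - q\<bar> > \<epsilon>} \<subseteq> A k (q + \<epsilon>) \<union> A k (q - \<epsilon>)"
    proof
      fix \<omega> assume "\<omega> \<in> {\<omega> \<in> space M. \<bar>?O k \<omega> - q\<bar> > \<epsilon>}"
      then consider "\<omega> \<in> space M" "\<not> ?O k \<omega> \<le> q + \<epsilon>" | "\<omega> \<in> space M" "?O k \<omega> \<le> q - \<epsilon>"
        by fastforce
      then show "\<omega> \<in> A k (q + \<epsilon>) \<union> A k (q - \<epsilon>)"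
      proof cases
        \<comment> \<open>Too few observations lie below \<open>q + \<epsilon>\<close>: their
          proportion is less than \<open>p + d\<close>, hence at least \<open>d\<close> below
          \<open>F (q + \<epsilon>)\<close>. The other case mirrors this at
          \<open>q - \<epsilon>\<close>.\<close>
        case 1
        then have "N k (q + \<epsilon>) \<omega> \<le> i k"
          using k by (simp add: order_statistic_le_iff N_def)
        then have "N k (q + \<epsilon>) \<omega> / n k \<le> i k / n k"
          by (simp add: divide_right_mono)
        then have "\<omega> \<in> A k (q + \<epsilon>)"
          using 1 k d by (auto simp: A_def)
        then show ?thesis by simp
      next
        case 2
        then have "N k (q - \<epsilon>) \<omega> \<ge> i k"
          using k by (simp add: order_statistic_le_iff N_def)
        then have "N k (q - \<epsilon>) \<omega> / n k \<ge> i k / n k"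
          by (simp add: divide_right_mono)
        then have "\<omega> \<in> A k (q - \<epsilon>)"
          using 2 k d by (auto simp: A_def)
        then show ?thesis by simp
      qed
    qed
    then have "prob {\<omega> \<in> space M. \<bar>?O k \<omega> - q\<bar> > \<epsilon>} \<le> prob (A k (q + \<epsilon>) \<union> A k (q - \<epsilon>))"
      by (intro finite_measure_mono) auto
    also have "\<dots> \<le> prob (A k (q + \<epsilon>)) + prob (A k (q - \<epsilon>))"
      by (intro measure_Un_le) auto
    also have "\<dots> \<le> 2 * exp (- 2 * real (n k) * d\<^sup>2) + 2 * exp (- 2 * real (n k) * d\<^sup>2)"
      by (intro add_mono A_bound) (use k in auto)
    finally show ?case by simp
  qed
  have "filterlim (\<lambda>k. (2 * d\<^sup>2) * real (n k)) at_top sequentially"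
    using d(1) by (intro filterlim_tendsto_pos_mult_at_top[OF tendsto_const]
        filterlim_compose[OF filterlim_real_sequentially n]) simp
  then have "(\<lambda>k. exp (- ((2 * d\<^sup>2) * real (n k)))) \<longlonglongrightarrow> 0"
    by (intro filterlim_compose[OF exp_at_bot] filterlim_compose[OF filterlim_uminus_at_bot_at_top])
  then have "(\<lambda>k. 4 * exp (- 2 * real (n k) * d\<^sup>2)) \<longlonglongrightarrow> 0"
    by (intro tendsto_mult_right_zero) (simp add: mult_ac)
  from tendsto_sandwich[OF _ bound tendsto_const this]
  show "(\<lambda>k. prob {\<omega> \<in> space M. \<bar>?O k \<omega> - q\<bar> > \<epsilon>}) \<longlonglongrightarrow> 0"
    by simp
qed simp

section \<open>Continuous mapping for two sequences with constant limits\<close>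

text \<open>If both coordinates are close to their limits, continuity at the single point
  \<open>(a, b)\<close> controls \<open>g\<close>; the two exceptional events are handled by a union
  bound. Continuity elsewhere is not assumed, since the log ratio lacks it.\<close>

lemma (in prob_space) converges_in_probability_isCont:
  fixes g :: "real \<times> real \<Rightarrow> real"
  assumes A: "converges_in_probability M A (\<lambda>_. a)"
    and B: "converges_in_probability M B (\<lambda>_. b)"
    and g: "isCont g (a, b)" "g \<in> borel_measurable borel"
  shows "converges_in_probability M (\<lambda>k \<omega>. g (A k \<omega>, B k \<omega>)) (\<lambda>_. g (a, b))"
  unfolding converges_in_probability_def
proof (intro conjI allI impI)
  have [measurable]: "A k \<in> borel_measurable M" "B k \<in> borel_measurable M" for k
    using A B by (auto simp: converges_in_probability_def)
  note g(2) [measurable]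
  show "(\<lambda>\<omega>. g (A k \<omega>, B k \<omega>)) \<in> borel_measurable M" for k
    by measurable
  fix \<epsilon> :: real assume "\<epsilon> > 0"
  with g(1) obtain d where d: "d > 0"
    "\<And>z. dist z (a, b) < d \<Longrightarrow> dist (g z) (g (a, b)) < \<epsilon>"
    unfolding continuous_at_eps_delta by blast
  \<comment> \<open>Outside both events the errors add up to at most \<open>2 * d / 3\<close>,
    strictly less than \<open>d\<close>; with \<open>d / 2\<close> the sum could equal
    \<open>d\<close>.\<close>
  let ?E = "\<lambda>Z c k. {\<omega> \<in> space M. \<bar>Z k \<omega> - c\<bar> > d / 3}"
  have le: "prob {\<omega> \<in> space M. \<bar>g (A k \<omega>, B k \<omega>) - g (a, b)\<bar> > \<epsilon>} \<le> prob (?E A a k) + prob (?E B b k)" for k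
  proof -
    have "{\<omega> \<in> space M. \<bar>g (A k \<omega>, B k \<omega>) - g (a, b)\<bar> > \<epsilon>} \<subseteq> ?E A a k \<union> ?E B b k"
    proof (rule subsetI, rule ccontr)
      fix \<omega> assume \<omega>: "\<omega> \<in> {\<omega> \<in> space M. \<bar>g (A k \<omega>, B k \<omega>) - g (a, b)\<bar> > \<epsilon>}"
        "\<omega> \<notin> ?E A a k \<union> ?E B b k"
      have "dist (A k \<omega>, B k \<omega>) (a, b) \<le> \<bar>A k \<omega> - a\<bar> + \<bar>B k \<omega> - b\<bar>"
        using sqrt_sum_squares_le_sum_abs[of "A k \<omega> - a" "B k \<omega> - b"]
        by (simp add: dist_prod_def dist_real_def)
      also have "\<dots> < d"
        using \<omega> d(1) by auto
      finally show False
        using d(2)[of "(A k \<omega>, B k \<omega>)"] \<omega> by (simp add: dist_real_def)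
    qed
    then have "prob {\<omega> \<in> space M. \<bar>g (A k \<omega>, B k \<omega>) - g (a, b)\<bar> > \<epsilon>} \<le> prob (?E A a k \<union> ?E B b k)"
      by (intro finite_measure_mono) auto
    also have "\<dots> \<le> prob (?E A a k) + prob (?E B b k)"
      by (intro measure_Un_le) auto
    finally show ?thesis .
  qed
  have "(\<lambda>k. prob (?E Z c k)) \<longlonglongrightarrow> 0" if "converges_in_probability M Z (\<lambda>_. c)" for Z c
    using that d(1) unfolding converges_in_probability_def by (auto dest!: spec[of _ "d / 3"])
  from this[OF A] this[OF B] have "(\<lambda>k. prob (?E A a k) + prob (?E B b k)) \<longlonglongrightarrow> 0"
    using tendsto_add by fastforce
  from tendsto_sandwich[OF _ _ tendsto_const this]
  show "(\<lambda>k. prob {\<omega> \<in> space M. \<bar>g (A k \<omega>, B k \<omega>) - g (a, b)\<bar> > \<epsilon>}) \<longlonglongrightarrow> 0"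
    using le by simp
qed simp

section \<open>Quantiles of a distribution function\<close>

context real_distribution
begin

text \<open>The distribution function tends to 0 at minus infinity. Without a lower bound the real
  \<open>Inf\<close> would carry no information.\<close>

lemma bdd_below_cdf_superlevel:
  assumes "p > 0"
  shows "bdd_below {x. p \<le> cdf M x}"
proof -
  have "\<forall>\<^sub>F x in at_bot. cdf M x < p"
    using order_tendstoD(2)[OF cdf_lim_at_bot assms] .
  then obtain N where "\<And>x. x \<le> N \<Longrightarrow> cdf M x < p"
    by (auto simp: eventually_at_bot_linorder)
  then have "N \<le> x" if "p \<le> cdf M x" for x
    using that by (metis linorder_le_cases not_less)
  then show ?thesis by (auto simp: bdd_below_def)
qed

lemma cdf_less_if_less_quantile:
  assumes "p > 0" "x < quantile (cdf M) p"
  shows "cdf M x < p"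
proof (rule ccontr)
  assume "\<not> cdf M x < p"
  then have "quantile (cdf M) p \<le> x"
    unfolding quantile_def using bdd_below_cdf_superlevel[OF assms(1)] by (intro cInf_lower) auto
  with assms(2) show False by simp
qed

text \<open>Right continuity makes the infimum attained: a value below \<open>p\<close> at
  \<open>?q\<close> would persist on an interval to its right, while points of level at least
  \<open>p\<close> come arbitrarily close to \<open>?q\<close>.\<close>

lemma le_cdf_quantile:
  assumes "0 < p" "p < 1"
  shows "p \<le> cdf M (quantile (cdf M) p)"
proof (rule ccontr)
  let ?q = "quantile (cdf M) p"
  assume "\<not> p \<le> cdf M ?q"
  moreover have "(cdf M \<longlongrightarrow> cdf M ?q) (at_right ?q)"
    using cdf_is_right_cont[of ?q] by (simp add: continuous_within)
  ultimately have "\<forall>\<^sub>F x in at_right ?q. cdf M x < p"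
    by (intro order_tendstoD(2)) auto
  then obtain b where b: "b > ?q" "\<And>y. ?q < y \<Longrightarrow> y < b \<Longrightarrow> cdf M y < p"
    unfolding eventually_at_right_field by blast
  have "\<forall>\<^sub>F x in at_top. p < cdf M x"
    using order_tendstoD(1)[OF cdf_lim_at_top_prob assms(2)] .
  then have "{x. p \<le> cdf M x} \<noteq> {}"
    by (auto simp: eventually_at_top_linorder intro!: less_imp_le)
  moreover have "Inf {x. p \<le> cdf M x} < b"
    using b(1) by (simp add: quantile_def)
  ultimately obtain x where x: "p \<le> cdf M x" "x < b"
    by (metis (mono_tags, lifting) cInf_lessD mem_Collect_eq)
  \<comment> \<open>The midpoint lies in the interval where \<open>cdf M\<close> is below
    \<open>p\<close>. But \<open>x\<close> is neither below \<open>?q\<close>, by the infimum, nor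
    equal to it, by assumption, and lying between \<open>?q\<close> and \<open>b\<close> would
    contradict the choice of \<open>b\<close>.\<close>
  have "\<not> cdf M ((?q + b) / 2) < p"
    using cdf_less_if_less_quantile[OF assms(1), of x] x b
      cdf_nondecreasing[of x "(?q + b) / 2"] \<open>\<not> p \<le> cdf M ?q\<close>
    by (metis cdf_nondecreasing linorder_neqE_linordered_idom not_less)
  with b show False by simp
qed

text \<open>A quantile at or below 0 would give \<open>p <= cdf M 0 = 0\<close> by
  monotonicity.\<close>

lemma quantile_pos:
  assumes "0 < p" "p < 1" "cdf M 0 = 0"
  shows "quantile (cdf M) p > 0"
proof (rule ccontr)
  assume "\<not> quantile (cdf M) p > 0"
  then have "cdf M (quantile (cdf M) p) \<le> cdf M 0"
    by (intro cdf_nondecreasing) simp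
  with le_cdf_quantile[OF assms(1,2)] assms show False by simp
qed

text \<open>A positive derivative excludes a flat stretch of level \<open>p\<close> to the right of
  the quantile. It gives strict growth only for small steps, whence the step \<open>h\<close> below;
  monotonicity carries this on to \<open>e\<close>.\<close>

lemma less_cdf_if_quantile_less:
  assumes "0 < p" "p < 1" "(cdf M has_real_derivative D) (at (quantile (cdf M) p))" "D > 0" "e > 0"
  shows "p < cdf M (quantile (cdf M) p + e)"
proof -
  let ?q = "quantile (cdf M) p"
  obtain d where d: "d > 0" "\<And>h. 0 < h \<Longrightarrow> h < d \<Longrightarrow> cdf M ?q < cdf M (?q + h)"
    using DERIV_pos_inc_right[OF assms(3,4)] by blast
  define h where "h = min e (d / 2)"
  have "p \<le> cdf M ?q"
    by (rule le_cdf_quantile[OF assms(1,2)])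
  also have "\<dots> < cdf M (?q + h)"
    using d assms(5) by (simp add: h_def min_def)
  also have "\<dots> \<le> cdf M (?q + e)"
    by (intro cdf_nondecreasing) (simp add: h_def)
  finally show ?thesis .
qed

end

section \<open>The log ratio of the order statistics at levels s/(s+1) and 1/(s+1)\<close>

theorem theorem2:
  fixes M :: "'a measure"
    and X :: "'a \<Rightarrow> real"
    and Y :: "nat \<Rightarrow> nat \<Rightarrow> 'a \<Rightarrow> real"
    and F :: "real \<Rightarrow> real"
    and f :: "real \<Rightarrow> ennreal"
    and s :: nat
  assumes "prob_space M"
    and "s \<ge> 2"
    and "X \<in> borel_measurable M"
    and "measure M {\<omega> \<in> space M. X \<omega> > 0} = 1"
    and "F = cdf (distr M borel X)"
    and "distributed M lborel X f"
    and "\<And>x D. (F has_real_derivative D) (at x) \<Longrightarrow> f x = ennreal D"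
    and "\<And>k. k \<ge> 1 \<Longrightarrow> prob_space.indep_vars M (\<lambda>_. borel) (Y k) {1..(s + 1) * k - 1}"
    and "\<And>k i. k \<ge> 1 \<Longrightarrow> i \<in> {1..(s + 1) * k - 1} \<Longrightarrow> distr M borel (Y k i) = distr M borel X"
    and "F differentiable (at (quantile F (1 / (real s + 1))))"
    and "f (quantile F (1 / (real s + 1))) \<in> {0<..<\<infinity>}"
    and "F differentiable (at (quantile F (real s / (real s + 1))))"
    and "f (quantile F (real s / (real s + 1))) \<in> {0<..<\<infinity>}"
  shows "converges_in_probability M
           (\<lambda>k \<omega>. ln (order_statistic (k * s) ((s + 1) * k - 1) (Y k) \<omega> /
                      order_statistic k ((s + 1) * k - 1) (Y k) \<omega>))
           (\<lambda>_. ln (quantile F (real s / (real s + 1)) / quantile F (1 / (real s + 1))))"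
proof -
  interpret prob_space M by fact
  note X [measurable] = assms(3)
  interpret D: real_distribution "distr M borel X"
    by (rule real_distribution_distr) (rule X)
  define n where "n = (\<lambda>k. (s + 1) * k - 1)"
  have s: "s \<ge> 2" by fact
  \<comment> \<open>The hypotheses cover \<open>k >= 1\<close>; for \<open>k = 0\<close> truncated
    subtraction gives \<open>n 0 = 0\<close>, and independence of the empty family is
    vacuous.\<close>
  have indep: "indep_vars (\<lambda>_. borel) (Y k) {1..n k}" for k
  proof (cases "k = 0")
    case True
    then show ?thesis by (simp add: n_def indep_vars_def indep_sets_def)
  next
    case False
    with assms(8)[of k] show ?thesis by (simp add: n_def)
  qed
  have distr: "distr M borel (Y k j) = distr M borel X" if "j \<in> {1..n k}" for k j
    using assms(9)[of k j] that by (cases "k = 0") (auto simp: n_def)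
  have n: "filterlim n at_top sequentially"
  proof (rule filterlim_at_top_mono[OF filterlim_ident always_eventually], rule allI)
    fix k
    have "1 * k \<le> s * k" using s by (intro mult_right_mono) auto
    then show "k \<le> n k" by (cases k) (simp_all add: n_def)
  qed
  have lim: "(\<lambda>k. real (c * k) / real (n k)) \<longlonglongrightarrow> real c / (real s + 1)" for c
  proof -
    \<comment> \<open>Numerator and denominator are divided by \<open>k\<close>, which is possible
      for \<open>k > 0\<close>.\<close>
    have "(\<lambda>k. real c / ((real s + 1) - inverse (real k))) \<longlonglongrightarrow> real c / ((real s + 1) - 0)"
      by (intro tendsto_intros lim_inverse_n) simp
    moreover have "\<forall>\<^sub>F k in sequentially.
        real c / ((real s + 1) - inverse (real k)) = real (c * k) / real (n k)"
      using eventually_gt_at_top[of 0]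
    proof eventually_elim
      case (elim k)
      then have "(s + 1) * k \<ge> 1" by simp
      then have "real (n k) = (real s + 1) * real k - 1"
        unfolding n_def by (subst of_nat_diff) (auto simp: algebra_simps)
      also have "\<dots> = ((real s + 1) - inverse (real k)) * real k"
        using elim by (simp add: algebra_simps)
      finally show ?case using elim by simp
    qed
    ultimately show ?thesis by (simp add: tendsto_cong)
  qed
  \<comment> \<open>To be used with \<open>c = s\<close> and \<open>c = 1\<close>. The bound
    \<open>c <= s\<close> keeps the rank in range: \<open>c * k <= s * k <= (s + 1) * k - 1\<close>
    once \<open>k >= 1\<close>.\<close>
  have conv: "converges_in_probability M (\<lambda>k. order_statistic (c * k) (n k) (Y k))
      (\<lambda>_. quantile F (real c / (real s + 1)))"
    if c: "0 < c" "c \<le> s" and diff: "F differentiable (at (quantile F (real c / (real s + 1))))"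
      and f: "f (quantile F (real c / (real s + 1))) \<in> {0<..<\<infinity>}" for c
  proof (rule order_statistic_converges_in_probability[OF X indep distr _ n lim])
    have p: "0 < real c / (real s + 1)" "real c / (real s + 1) < 1"
      using c by auto
    show "\<forall>\<^sub>F k in sequentially. 1 \<le> c * k \<and> c * k \<le> n k"
      using eventually_gt_at_top[of 0]
    proof eventually_elim
      case (elim k)
      have "c * k \<le> s * k" using c by (intro mult_right_mono) auto
      with elim c show ?case by (cases k) (simp_all add: n_def)
    qed
    obtain D where D: "(F has_real_derivative D) (at (quantile F (real c / (real s + 1))))"
      using diff by (auto simp: real_differentiable_def)
    \<comment> \<open>A density is determined only almost everywhere; the hypothesis equating
      \<open>f\<close> with the derivative gives its value here a meaning. As \<open>ennreal\<close>
      sends nonpositive reals to 0, positivity of \<open>f\<close> yields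
      \<open>D > 0\<close>.\<close>
    with assms(7)[OF D] f have "D > 0" by simp
    fix e :: real assume "e > 0"
    show "cdf (distr M borel X) (quantile F (real c / (real s + 1)) - e) < real c / (real s + 1)"
      using D.cdf_less_if_less_quantile[OF p(1)] \<open>e > 0\<close> by (simp add: assms(5))
    show "real c / (real s + 1) < cdf (distr M borel X) (quantile F (real c / (real s + 1)) + e)"
      using D.less_cdf_if_quantile_less[OF p _ \<open>D > 0\<close> \<open>e > 0\<close>] D by (simp add: assms(5))
  qed
  have "cdf (distr M borel X) 0 = prob {\<omega> \<in> space M. \<not> X \<omega> > 0}"
    by (auto simp: cdf_def measure_distr not_less intro!: arg_cong[where f = prob])
  also have "\<dots> = 0"
    using assms(4) by (subst prob_neg) auto
  finally have F0: "cdf (distr M borel X) 0 = 0" .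
  have pos: "quantile F (real c / (real s + 1)) > 0" if "0 < c" "c \<le> s" for c
    unfolding assms(5) by (rule D.quantile_pos[OF _ _ F0]) (use that in auto)
  define a where "a = quantile F (real s / (real s + 1))"
  define b where "b = quantile F (1 / (real s + 1))"
  have ab: "a > 0" "b > 0"
    using pos[of s] pos[of 1] s by (simp_all add: a_def b_def)
  \<comment> \<open>The log ratio is written as a function applied to a pair, so that the continuous
    mapping rule can match it; positivity of \<open>a\<close> and \<open>b\<close> gives continuity
    there.\<close>
  have "converges_in_probability M
      (\<lambda>k \<omega>. (\<lambda>z. ln (fst z / snd z)) (order_statistic (s * k) (n k) (Y k) \<omega>,
        order_statistic (1 * k) (n k) (Y k) \<omega>)) (\<lambda>_. (\<lambda>z. ln (fst z / snd z)) (a, b))"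
  proof (rule converges_in_probability_isCont)
    show "isCont (\<lambda>z. ln (fst z / snd z)) (a, b)"
      using ab by (intro continuous_intros) auto
    show "(\<lambda>z :: real \<times> real. ln (fst z / snd z)) \<in> borel_measurable borel"
      \<comment> \<open>Measurability of the projections is available for the product sigma-algebra,
        which here equals the Borel one.\<close>
      unfolding borel_prod[symmetric] by measurable
    show "converges_in_probability M (\<lambda>k. order_statistic (s * k) (n k) (Y k)) (\<lambda>_. a)"
      unfolding a_def by (rule conv) (use s assms(12,13) in auto)
    show "converges_in_probability M (\<lambda>k. order_statistic (1 * k) (n k) (Y k)) (\<lambda>_. b)"
      using conv[of 1] s assms(10,11) by (simp add: b_def)
  qed
  then show ?thesis
    by (simp add: a_def b_def n_def mult.commute)
qed

end
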